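(* Let $X_0=\sigma u v^\top\in\mathbb{R}^{m\times n}$ with $\sigma>0$, $\|u\|=\|v\|=1$, and suppose all entries are observed without noise, i.e. $\Omega=[m]\times[n]$ and $X=X_0$. Let $(u_1,v_1)$ be unit vectors with $u^\top u_1>0$ and $v^\top v_1>0$, let $(u_t,v_t)_{t\ge1}$ be the sequence of estimates generated by \texttt{R2RILS} (with rank $r=1$) from $(u_1,v_1)$, and put $\alpha_t=u^\top u_t$, $\beta_t=v^\top v_t$, $\epsilon_t=\sqrt{1-\alpha_t^2}$, $\delta_t=\sqrt{1-\beta_t^2}$. Then as $\epsilon_t,\delta_t\to 0$ the convergence of $(u_t,v_t)$ to $(u,v)$ is quadratic, with asymptotic contraction factor $\sqrt{\epsilon_t^4 - \epsilon_t^2 \delta_t^2 + \delta_t^4} \leq \sqrt{2}\, \max\{\epsilon_t^2, \delta_t^2\}$; that is, for $(\epsilon_t,\delta_t)\neq(0,0)$, $$\frac{\left\| \begin{pmatrix} u_{t+1} \\ v_{t+1} \end{pmatrix} - \begin{pmatrix} u \\ v \end{pmatrix} \right\|}{\left\| \begin{pmatrix} u_t \\ v_t \end{pmatrix} - \begin{pmatrix} u \\ v \end{pmatrix} \right\|}=\sqrt{\epsilon_t^4 - \epsilon_t^2 \delta_t^2 + \delta_t^4}\cdot(1+o(1))\qquad\text{as }(\epsilon_t,\delta_t)\to(0,0).$$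
   Context: $\|\cdot\|$ is the Euclidean norm. The \texttt{R2RILS} algorithm in the rank-1 case with all entries of an $m\times n$ matrix $X$ observed: given unit vectors $(u_t,v_t)\in\mathbb{R}^m\times\mathbb{R}^n$, Step I: let $(\tilde u_t,\tilde v_t)$ be the minimizer of $\|u_t b^\top + a v_t^\top - X\|_F$ over $(a,b)\in\mathbb{R}^m\times\mathbb{R}^n$ having the smallest Euclidean norm $\sqrt{\|a\|^2+\|b\|^2}$ among all minimizers (it is unique). Step II: with $\mathrm{ColNorm}(x)=x/\|x\|$ for a nonzero vector $x$, set $u_{t+1}=\mathrm{ColNorm}(u_t+\mathrm{ColNorm}(\tilde u_t))$ and $v_{t+1}=\mathrm{ColNorm}(v_t+\mathrm{ColNorm}(\tilde v_t))$. "Contraction factor" means the ratio of the error $\|(u_{t+1},v_{t+1})-(u,v)\|$ to the error $\|(u_t,v_t)-(u,v)\|$. *)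

theory Defs
  imports "HOL-Analysis.Analysis"
begin

definition outer :: "real ^ 'm \<Rightarrow> real ^ 'n \<Rightarrow> real ^ 'n ^ 'm" where
  "outer x y = (\<chi> i j. x $ i * y $ j)"

(* The library norm on real ^ 'n ^ 'm is the L2 norm of the L2 norms of the rows, i.e. the
   Frobenius norm. *)
definition lsq_residual ::
  "real ^ 'n ^ 'm \<Rightarrow> real ^ 'm \<Rightarrow> real ^ 'n \<Rightarrow> (real ^ 'm) \<times> (real ^ 'n) \<Rightarrow> real" where
  "lsq_residual X x y = (\<lambda>(a, b). norm (outer x b + outer a y - X))"

(* The inner is_arg_min singles out the least-squares minimizers, the outer one the minimizer
   of least norm among them; the norm on pairs is sqrt (norm a ^ 2 + norm b ^ 2). *)
definition min_norm_lsq ::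
  "real ^ 'n ^ 'm \<Rightarrow> real ^ 'm \<Rightarrow> real ^ 'n \<Rightarrow> (real ^ 'm) \<times> (real ^ 'n)" where
  "min_norm_lsq X x y =
     (THE p. is_arg_min norm (is_arg_min (lsq_residual X x y) (\<lambda>_. True)) p)"

(* ColNorm is the library function sgn, with sgn x = x /\<^sub>R norm x (and sgn 0 = 0). *)
definition r2rils_step ::
  "real ^ 'n ^ 'm \<Rightarrow> (real ^ 'm) \<times> (real ^ 'n) \<Rightarrow> (real ^ 'm) \<times> (real ^ 'n)" where
  "r2rils_step X = (\<lambda>(x, y). case min_norm_lsq X x y of (a, b) \<Rightarrow>
     (sgn (x + sgn a), sgn (y + sgn b)))"

(* The iterates are numbered from 1; the values at 0 are irrelevant. *)
definition r2rils_run ::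
  "real ^ 'n ^ 'm \<Rightarrow> (nat \<Rightarrow> real ^ 'm) \<Rightarrow> (nat \<Rightarrow> real ^ 'n) \<Rightarrow> bool" where
  "r2rils_run X us vs \<longleftrightarrow>
     norm (us 1) = 1 \<and> norm (vs 1) = 1 \<and>
     (\<forall>t\<ge>1. (us (t + 1), vs (t + 1)) = r2rils_step X (us t, vs t))"

definition converges_quadratically :: "(nat \<Rightarrow> 'a::real_normed_vector) \<Rightarrow> 'a \<Rightarrow> bool" where
  "converges_quadratically z l \<longleftrightarrow>
     z \<longlonglongrightarrow> l \<and>
     (\<exists>C. \<forall>\<^sub>F t in sequentially. norm (z (t + 1) - l) \<le> C * (norm (z t - l))\<^sup>2)"

(* sine of the angle between unit vectors x and y *)
definition misalignment :: "'a::real_inner \<Rightarrow> 'a \<Rightarrow> real" where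
  "misalignment x y = sqrt (1 - (x \<bullet> y)\<^sup>2)"

definition contraction_factor :: "real \<Rightarrow> real \<Rightarrow> real" where
  "contraction_factor \<epsilon> \<delta> = sqrt (\<epsilon> ^ 4 - \<epsilon>\<^sup>2 * \<delta>\<^sup>2 + \<delta> ^ 4)"

end

theory Submission
  imports Defs
begin

text \<open>For unit vectors x and y, the least-squares problem is underdetermined exactly by the direction
  (x, - y), so the minimal-norm minimizer is, with \<open>\<alpha> = u \<bullet> x\<close> and \<open>\<beta> = v \<bullet> y\<close>,
  \<open>a = \<sigma> \<beta> (u - (\<alpha> / 2) x)\<close> and \<open>b = \<sigma> \<alpha> (v - (\<beta> / 2) y)\<close>. After normalization the two factors
  decouple, and each one is governed by a single scalar map \<open>\<alpha> \<mapsto> \<alpha>'\<close>. With \<open>\<epsilon>\<^sup>2 = 1 - \<alpha>\<^sup>2\<close> it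
  satisfies \<open>2 (1 - \<alpha>') = \<epsilon>\<^sup>6 (1 + o(1))\<close>, while \<open>2 (1 - \<alpha>) = \<epsilon>\<^sup>2 (1 + o(1))\<close>. Since these are the
  squared errors, the squared contraction factor is asymptotically
  \<open>(\<epsilon>\<^sup>6 + \<delta>\<^sup>6) / (\<epsilon>\<^sup>2 + \<delta>\<^sup>2) = \<epsilon>\<^sup>4 - \<epsilon>\<^sup>2 \<delta>\<^sup>2 + \<delta>\<^sup>4\<close>. Globally, each step at least halves the tangent of
  the angle to the target.\<close>

section \<open>The least-squares step\<close>

lemma inner_outer: "outer x y \<bullet> outer z w = (x \<bullet> z) * (y \<bullet> w)"
  by (simp add: outer_def inner_vec_def sum_product sum_distrib_left ac_simps)

lemma outer_add_left: "outer (x + x') y = outer x y + outer x' y"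
  and outer_add_right: "outer x (y + y') = outer x y + outer x y'"
  and outer_diff_left: "outer (x - x') y = outer x y - outer x' y"
  and outer_diff_right: "outer x (y - y') = outer x y - outer x y'"
  and outer_scaleR_left: "outer (c *\<^sub>R x) y = c *\<^sub>R outer x y"
  and outer_scaleR_right: "outer x (c *\<^sub>R y) = c *\<^sub>R outer x y"
  by (simp_all add: outer_def vec_eq_iff algebra_simps)

lemmas outer_simps = outer_add_left outer_add_right outer_diff_left outer_diff_right
  outer_scaleR_left outer_scaleR_right

lemma norm_outer: "norm (outer x y) = norm x * norm y"
  by (simp add: norm_eq_sqrt_inner inner_outer real_sqrt_mult)

text \<open>Pairing the vanishing sum with \<open>outer ?e y\<close>, where
  \<open>?e = c + (d \<bullet> y) *\<^sub>R x\<close>, returns \<open>?e \<bullet> ?e\<close>. The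
  kernel of the least-squares map is thus the line through \<open>(x, - y)\<close>.\<close>

lemma outer_sum_eq_0D:
  fixes x :: "real ^ 'm" and y :: "real ^ 'n"
  assumes x: "norm x = 1" and y: "norm y = 1" and 0: "outer x d + outer c y = 0"
  shows "c = - (d \<bullet> y) *\<^sub>R x" "d = (d \<bullet> y) *\<^sub>R y"
proof -
  have xx: "x \<bullet> x = 1" and yy: "y \<bullet> y = 1"
    using x y by (simp_all add: norm_eq_1)
  let ?e = "c + (d \<bullet> y) *\<^sub>R x"
  have "(outer x d + outer c y) \<bullet> outer ?e y = ?e \<bullet> ?e"
    by (simp add: inner_outer inner_add_left inner_add_right yy algebra_simps inner_commute)
  then have "?e = 0" using 0 by simp
  then show c: "c = - (d \<bullet> y) *\<^sub>R x" by (simp add: eq_neg_iff_add_eq_0)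
  have "outer x d + outer c y = outer x (d - (d \<bullet> y) *\<^sub>R y)"
    by (subst c) (simp add: outer_def vec_eq_iff algebra_simps)
  then have "norm x * norm (d - (d \<bullet> y) *\<^sub>R y) = 0"
    using 0 by (metis norm_outer norm_zero)
  then show "d = (d \<bullet> y) *\<^sub>R y" using x by simp
qed

text \<open>Two orthogonality facts suffice. The residual of the claimed pair is orthogonal to the
  range of the linear map, so the minimizers are that pair plus the kernel; the pair itself is
  orthogonal to the kernel, so it is strictly the shortest of them.\<close>

lemma min_norm_lsq_rank1:
  fixes u x :: "real ^ 'm" and v y :: "real ^ 'n"
  assumes x: "norm x = 1" and y: "norm y = 1"
  shows "min_norm_lsq (\<sigma> *\<^sub>R outer u v) x y =
    ((\<sigma> * (v \<bullet> y)) *\<^sub>R (u - ((u \<bullet> x) / 2) *\<^sub>R x), (\<sigma> * (u \<bullet> x)) *\<^sub>R (v - ((v \<bullet> y) / 2) *\<^sub>R y))"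
proof -
  define X where "X = \<sigma> *\<^sub>R outer u v"
  define a where "a = (\<sigma> * (v \<bullet> y)) *\<^sub>R (u - ((u \<bullet> x) / 2) *\<^sub>R x)"
  define b where "b = (\<sigma> * (u \<bullet> x)) *\<^sub>R (v - ((v \<bullet> y) / 2) *\<^sub>R y)"
  let ?r = "lsq_residual X x y"
  have xx: "x \<bullet> x = 1" and yy: "y \<bullet> y = 1"
    using x y by (simp_all add: norm_eq_1)
  define R where "R = outer x b + outer a y - X"
  \<comment> \<open>The two halves in \<open>a\<close> and \<open>b\<close> add up to the full
    \<open>outer x y\<close> term, so the residual factors through the parts of \<open>u\<close> and
    \<open>v\<close> orthogonal to \<open>x\<close> and \<open>y\<close>.\<close>
  have R: "R = - \<sigma> *\<^sub>R outer (u - (u \<bullet> x) *\<^sub>R x) (v - (v \<bullet> y) *\<^sub>R y)"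
    by (simp add: R_def X_def a_def b_def outer_def vec_eq_iff field_simps)
  have pyth: "(?r (a + c, b + d))\<^sup>2 = (?r (a, b))\<^sup>2 + (norm (outer x d + outer c y))\<^sup>2" for c d
  proof -
    have "R \<bullet> outer x d = 0" "R \<bullet> outer c y = 0"
      by (simp_all add: R inner_outer inner_diff_left inner_diff_right xx yy)
    then have "R \<bullet> (outer x d + outer c y) = 0"
      by (simp add: inner_add_right)
    moreover have "outer x (b + d) + outer (a + c) y - X = R + (outer x d + outer c y)"
      by (simp add: R_def outer_simps)
    ultimately show ?thesis
      by (simp add: lsq_residual_def R_def[symmetric] power2_norm_eq_inner inner_add_left
          inner_add_right inner_commute)
  qed
  have minimizer: "is_arg_min ?r (\<lambda>_. True) (a + c, b + d) \<longleftrightarrow> outer x d + outer c y = 0" for c d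
  proof
    assume "is_arg_min ?r (\<lambda>_. True) (a + c, b + d)"
    then have "?r (a + c, b + d) \<le> ?r (a, b)"
      by (simp add: is_arg_min_linorder)
    then have "(?r (a + c, b + d))\<^sup>2 \<le> (?r (a, b))\<^sup>2"
      by (intro power_mono) (simp_all add: lsq_residual_def)
    then show "outer x d + outer c y = 0" using pyth[of c d] by simp
  next
    assume 0: "outer x d + outer c y = 0"
    have "?r (a + c, b + d) \<le> ?r q" for q
    proof (rule power2_le_imp_le)
      obtain c' d' where q: "q = (a + c', b + d')"
        by (metis add_diff_cancel_left' add.commute diff_add_cancel surj_pair)
      show "(?r (a + c, b + d))\<^sup>2 \<le> (?r q)\<^sup>2"
        unfolding q pyth 0 by simp
      show "0 \<le> ?r q" by (simp add: lsq_residual_def q)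
    qed
    then show "is_arg_min ?r (\<lambda>_. True) (a + c, b + d)"
      by (simp add: is_arg_min_linorder)
  qed
  have min0: "is_arg_min ?r (\<lambda>_. True) (a, b)"
    using minimizer[of 0 0] by (simp add: outer_def vec_eq_iff)
  \<comment> \<open>The even split of the \<open>outer x y\<close> term makes \<open>(a, b)\<close>
    orthogonal to \<open>(x, - y)\<close>; this cancels the terms linear in \<open>l\<close> in the
    norm expansion below.\<close>
  have balance: "a \<bullet> x = b \<bullet> y"
    by (simp add: a_def b_def inner_diff_left xx yy)
  have norm_sq: "\<exists>l. q = (a - l *\<^sub>R x, b + l *\<^sub>R y) \<and> (norm q)\<^sup>2 = (norm (a, b))\<^sup>2 + 2 * l\<^sup>2"
    if q: "is_arg_min ?r (\<lambda>_. True) q" for q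
  proof -
    obtain c d where q': "q = (a + c, b + d)"
      by (metis add_diff_cancel_left' add.commute diff_add_cancel surj_pair)
    define l where "l = d \<bullet> y"
    have 0: "outer x d + outer c y = 0" using q minimizer unfolding q' by blast
    have c: "c = - l *\<^sub>R x" and d: "d = l *\<^sub>R y"
      unfolding l_def by (rule outer_sum_eq_0D[OF x y 0])+
    have "(norm (a - l *\<^sub>R x, b + l *\<^sub>R y))\<^sup>2 = (norm (a, b))\<^sup>2 + 2 * l\<^sup>2"
      unfolding power2_norm_eq_inner inner_Pair using balance
      by (simp add: inner_diff_left inner_diff_right inner_add_left inner_add_right xx yy
          inner_commute[of x a] inner_commute[of y b] power2_eq_square algebra_simps)
    with q' c d show ?thesis by (intro exI[of _ l]) simp
  qed
  have "(THE p. is_arg_min norm (is_arg_min ?r (\<lambda>_. True)) p) = (a, b)"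
  proof (rule the_equality)
    have "norm (a, b) \<le> norm q" if q: "is_arg_min ?r (\<lambda>_. True) q" for q
    proof (rule power2_le_imp_le)
      obtain l where "(norm q)\<^sup>2 = (norm (a, b))\<^sup>2 + 2 * l\<^sup>2" using norm_sq[OF q] by blast
      then show "(norm (a, b))\<^sup>2 \<le> (norm q)\<^sup>2" using zero_le_power2[of l] by linarith
    qed simp
    then show "is_arg_min norm (is_arg_min ?r (\<lambda>_. True)) (a, b)"
      using min0 by (simp add: is_arg_min_linorder)
  next
    fix p assume p: "is_arg_min norm (is_arg_min ?r (\<lambda>_. True)) p"
    then have "is_arg_min ?r (\<lambda>_. True) p" and le: "norm p \<le> norm (a, b)"
      using min0 by (auto simp: is_arg_min_linorder)
    then obtain l where l: "p = (a - l *\<^sub>R x, b + l *\<^sub>R y)" "(norm p)\<^sup>2 = (norm (a, b))\<^sup>2 + 2 * l\<^sup>2"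
      using norm_sq by blast
    have "(norm p)\<^sup>2 \<le> (norm (a, b))\<^sup>2" using le by (intro power_mono) auto
    then have "l = 0" using l(2) by simp
    with l show "p = (a, b)" by simp
  qed
  then show ?thesis by (simp add: min_norm_lsq_def X_def a_def b_def)
qed

section \<open>The scalar alignment map\<close>

text \<open>For unit vectors \<open>u\<close>, \<open>x\<close> with
  \<open>u \<bullet> x = a\<close>, this is twice the norm of
  \<open>u - (a / 2) *\<^sub>R x\<close>, the direction of the least-squares factor.\<close>

definition align_root :: "real \<Rightarrow> real" where
  "align_root a = sqrt (4 - 3 * a\<^sup>2)"

text \<open>Normalizing that direction and adding \<open>x\<close> gives
  \<open>align_weight a *\<^sub>R x + (2 / align_root a) *\<^sub>R u\<close>. The weight of the old
  iterate vanishes at \<open>a = 1\<close>.\<close>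

definition align_weight :: "real \<Rightarrow> real" where
  "align_weight a = 1 - a / align_root a"

text \<open>Squared length of this combination of \<open>x\<close> and \<open>u\<close>;
  \<open>align_step\<close> is then the cosine between it and \<open>u\<close>.\<close>

definition align_sqnorm :: "real \<Rightarrow> real" where
  "align_sqnorm a = (align_weight a)\<^sup>2 + 2 * align_weight a * (2 / align_root a) * a
     + (2 / align_root a)\<^sup>2"

definition align_step :: "real \<Rightarrow> real" where
  "align_step a = (align_weight a * a + 2 / align_root a) / sqrt (align_sqnorm a)"

text \<open>The quotient of \<open>2 * (1 - align_step a)\<close> by
  \<open>(1 - a\<^sup>2) ^ 3\<close>, in a form that stays meaningful at
  \<open>a = 1\<close>.\<close>

definition align_gain :: "real \<Rightarrow> real" where
  "align_gain a = 32 / ((align_root a)\<^sup>2 * (align_root a + a)\<^sup>2 * align_sqnorm a * (1 + align_step a))"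

text \<open>\<open>sgn\<close> discards the positive multiplier \<open>c\<close>, the only place
  where the other factor enters, so one scalar recursion serves both factors.\<close>

lemma r2rils_factor_step:
  fixes u x :: "'a::real_inner"
  assumes u: "norm u = 1" and x: "norm x = 1" and ux: "u \<bullet> x > 0" and c: "c > 0"
    and x': "x' = sgn (x + sgn (c *\<^sub>R (u - ((u \<bullet> x) / 2) *\<^sub>R x)))"
  shows "norm x' = 1" "u \<bullet> x' = align_step (u \<bullet> x)"
proof -
  define a where "a = u \<bullet> x"
  define w where "w = u - (a / 2) *\<^sub>R x"
  let ?q = "align_root a" and ?s = "align_weight a" and ?k = "2 / align_root a"
  have uu: "u \<bullet> u = 1" and xx: "x \<bullet> x = 1"
    using u x by (simp_all add: norm_eq_1)
  have "a \<le> 1" using norm_cauchy_schwarz[of u x] u x by (simp add: a_def)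
  then have a2: "a\<^sup>2 \<le> 1" using ux by (simp add: a_def power_le_one)
  then have q0: "?q > 0" by (simp add: align_root_def)
  have "(norm w)\<^sup>2 = (?q / 2)\<^sup>2"
    unfolding power2_norm_eq_inner using a2
    by (simp add: w_def inner_diff_left inner_diff_right uu xx inner_commute[of x u]
        a_def[symmetric] align_root_def power_divide) (simp add: field_simps power2_eq_square)
  then have nw: "norm w = ?q / 2" using q0 by (simp add: power2_eq_iff_nonneg)
  have "x + sgn (c *\<^sub>R w) = x + ?k *\<^sub>R w"
    using c by (simp add: sgn_scaleR sgn_div_norm nw)
  also have "\<dots> = ?s *\<^sub>R x + ?k *\<^sub>R u"
    using q0 by (simp add: w_def align_weight_def algebra_simps)
  finally have z: "x + sgn (c *\<^sub>R w) = ?s *\<^sub>R x + ?k *\<^sub>R u" .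
  let ?z = "?s *\<^sub>R x + ?k *\<^sub>R u"
  have "(norm ?z)\<^sup>2 = align_sqnorm a"
    unfolding power2_norm_eq_inner
    by (simp add: inner_add_left inner_add_right uu xx inner_commute[of x u] a_def[symmetric]
        align_sqnorm_def power2_eq_square algebra_simps)
  then have nz: "norm ?z = sqrt (align_sqnorm a)" by (metis norm_ge_zero real_sqrt_unique)
  have "a \<le> ?q" unfolding align_root_def using a2 by (intro real_le_rsqrt) simp
  then have s0: "?s \<ge> 0" using q0 by (simp add: align_weight_def)
  have uz: "u \<bullet> ?z = ?s * a + ?k"
    by (simp add: inner_add_right uu a_def)
  \<comment> \<open>A positive inner product with \<open>u\<close> keeps the vector away from 0,
    where \<open>sgn\<close> would return 0 instead of a unit vector.\<close>
  have "?s * a + ?k > 0" using s0 q0 ux by (intro add_nonneg_pos) (simp_all add: a_def)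
  then have "?z \<noteq> 0" using uz by auto
  moreover have x'z: "x' = sgn ?z" using x' z by (simp add: w_def a_def)
  ultimately show "norm x' = 1" by (simp add: norm_sgn)
  show "u \<bullet> x' = align_step (u \<bullet> x)"
    unfolding x'z sgn_div_norm inner_scaleR_right uz nz align_step_def a_def[symmetric]
    by (simp add: divide_inverse_commute)
qed

context
  fixes a :: real
  assumes a_pos: "0 < a" and a_le_1: "a \<le> 1"
begin

lemma square_le_1: "a\<^sup>2 \<le> 1"
  using a_pos a_le_1 by (simp add: power_le_one)

lemma align_root_sq: "(align_root a)\<^sup>2 = 4 - 3 * a\<^sup>2"
  using square_le_1 by (simp add: align_root_def)

lemma align_root_bounds: "1 \<le> align_root a" "align_root a \<le> 2"
  using square_le_1 by (auto simp: align_root_def intro: real_le_lsqrt)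

text \<open>Rationalizing \<open>align_root a - a\<close> exposes the factor
  \<open>1 - a\<^sup>2\<close>: the old iterate survives with a weight of order
  \<open>\<epsilon>\<^sup>2\<close>, which lifts the squared error from order
  \<open>\<epsilon>\<^sup>2\<close> to \<open>\<epsilon>\<^sup>6\<close>.\<close>

lemma align_weight_eq: "align_weight a = 4 * (1 - a\<^sup>2) / (align_root a * (align_root a + a))"
proof -
  have "(align_root a - a) * (align_root a + a) = 4 * (1 - a\<^sup>2)"
    using align_root_sq by (simp add: algebra_simps power2_eq_square)
  moreover have "align_root a > 0" "align_root a + a > 0" using align_root_bounds a_pos by auto
  ultimately show ?thesis
    by (metis align_weight_def diff_divide_distrib divide_self less_irrefl
        mult_divide_mult_cancel_right)
qed

lemma align_weight_bounds:
  "0 \<le> align_weight a" "align_weight a \<le> 1" "align_weight a \<le> 4 * (1 - a\<^sup>2)"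
proof -
  show "0 \<le> align_weight a"
    using align_root_bounds a_pos square_le_1 by (simp add: align_weight_eq)
  show "align_weight a \<le> 1"
    using align_root_bounds a_pos by (simp add: align_weight_def)
  have "1 * 1 \<le> align_root a * (align_root a + a)"
    using align_root_bounds a_pos by (intro mult_mono) auto
  then have "4 * (1 - a\<^sup>2) / (align_root a * (align_root a + a)) \<le> 4 * (1 - a\<^sup>2) / 1"
    using square_le_1 by (intro divide_left_mono) auto
  then show "align_weight a \<le> 4 * (1 - a\<^sup>2)" by (simp add: align_weight_eq)
qed

lemma align_sqnorm_ge_1: "1 \<le> align_sqnorm a"
proof -
  have "1 \<le> (2 / align_root a)\<^sup>2" using align_root_bounds by (intro one_le_power) simp
  moreover have "0 \<le> 2 * align_weight a * (2 / align_root a) * a"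
    using align_weight_bounds align_root_bounds a_pos by simp
  ultimately show ?thesis unfolding align_sqnorm_def by (smt (verit) zero_le_power2)
qed

lemma align_step_pos: "0 < align_step a"
  using align_weight_bounds align_root_bounds a_pos align_sqnorm_ge_1
  by (auto simp: align_step_def intro!: divide_pos_pos add_nonneg_pos)

lemma align_step_sq:
  "(align_step a)\<^sup>2 = (align_weight a * a + 2 / align_root a)\<^sup>2 / align_sqnorm a"
  using align_sqnorm_ge_1 by (simp add: align_step_def power_divide)

text \<open>Adding a multiple of \<open>u\<close> leaves the component orthogonal to
  \<open>u\<close> unchanged, so before normalization it is \<open>align_weight a\<close> times that
  of \<open>x\<close>.\<close>

lemma one_minus_align_step_sq:
  "1 - (align_step a)\<^sup>2 = (1 - a\<^sup>2) * (align_weight a)\<^sup>2 / align_sqnorm a"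
proof -
  have "align_sqnorm a - (align_weight a * a + 2 / align_root a)\<^sup>2 = (1 - a\<^sup>2) * (align_weight a)\<^sup>2"
    by (simp add: align_sqnorm_def power2_eq_square algebra_simps)
  then show ?thesis
    using align_sqnorm_ge_1 by (simp add: align_step_sq field_simps)
qed

lemma align_step_le_1: "align_step a \<le> 1"
proof -
  have "0 \<le> 1 - (align_step a)\<^sup>2"
    using square_le_1 align_sqnorm_ge_1 by (simp add: one_minus_align_step_sq)
  then show ?thesis using align_step_pos by (simp add: power_le_one_iff)
qed

lemma align_step_error: "2 * (1 - align_step a) = (1 - a\<^sup>2) ^ 3 * align_gain a"
proof -
  have "2 * (1 - align_step a) = 2 * (1 - (align_step a)\<^sup>2) / (1 + align_step a)"
    using align_step_pos by (simp add: field_simps power2_eq_square)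
  also have "\<dots> = (1 - a\<^sup>2) ^ 3 * align_gain a"
    unfolding one_minus_align_step_sq align_weight_eq align_gain_def power_divide power_mult_distrib
    by (simp add: power3_eq_cube power2_eq_square[of "1 - a\<^sup>2"])
  finally show ?thesis .
qed

text \<open>Since \<open>2 * (1 - a)\<close> is a squared distance of unit vectors, this is
  quadratic convergence of one factor with constant 8.\<close>

lemma align_step_error_quadratic: "2 * (1 - align_step a) \<le> 64 * (2 * (1 - a))\<^sup>2"
proof -
  have e: "0 \<le> 1 - a\<^sup>2" "1 - a\<^sup>2 \<le> 1" "1 - a\<^sup>2 \<le> 2 * (1 - a)"
    using square_le_1 sum_power2_ge_zero[of "a - 1" 0] by (auto simp: power2_eq_square algebra_simps)
  have "1 - align_step a \<le> 1 - (align_step a)\<^sup>2"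
    using align_step_pos align_step_le_1 by (simp add: power_le_one_iff power2_eq_square mult_left_le)
  also have "\<dots> \<le> (1 - a\<^sup>2) * (align_weight a)\<^sup>2 / 1"
    unfolding one_minus_align_step_sq
    using align_sqnorm_ge_1 e by (intro divide_left_mono) auto
  \<comment> \<open>One factor \<open>1 - a\<^sup>2\<close> is given up here: order two is
    enough.\<close>
  also have "\<dots> \<le> 1 * (4 * (1 - a\<^sup>2))\<^sup>2"
    unfolding div_by_1 using align_weight_bounds e by (intro mult_mono power_mono) auto
  also have "\<dots> = 16 * (1 - a\<^sup>2)\<^sup>2" unfolding power_mult_distrib by simp
  also have "\<dots> \<le> 16 * (2 * (1 - a))\<^sup>2"
    using e by (intro mult_left_mono power_mono) auto
  finally have "2 * (1 - align_step a) \<le> 32 * (2 * (1 - a))\<^sup>2" by simp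
  \<comment> \<open>Relaxing 32 to 64 gives the final bound the integer constant 8.\<close>
  also have "\<dots> \<le> 64 * (2 * (1 - a))\<^sup>2" by (intro mult_right_mono) auto
  finally show ?thesis .
qed

text \<open>The quantity \<open>1 / a\<^sup>2 - 1\<close> is the squared tangent of the angle.\<close>

lemma align_step_tangent: "1 / (align_step a)\<^sup>2 - 1 \<le> (1 / a\<^sup>2 - 1) / 4"
proof -
  let ?s = "align_weight a" and ?k = "2 / align_root a"
  have k: "1 \<le> ?k" using align_root_bounds by simp
  \<comment> \<open>\<open>?s * a \<le> 1 \<le> ?k\<close> makes the component along
    \<open>u\<close> at least twice \<open>?s * a\<close>, whence the factor 1/4 for the squared
    tangent.\<close>
  have "?s * a \<le> 1 * 1" using align_weight_bounds a_pos a_le_1 by (intro mult_mono) auto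
  then have "2 * (?s * a) \<le> ?s * a + ?k" using k by linarith
  then have sq: "4 * (?s\<^sup>2 * a\<^sup>2) \<le> (?s * a + ?k)\<^sup>2"
    using power_mono[of "2 * (?s * a)" "?s * a + ?k" 2] align_weight_bounds a_pos
    by (simp add: power_mult_distrib)
  have pos: "?s * a + ?k > 0"
    using k mult_nonneg_nonneg[OF align_weight_bounds(1), of a] a_pos by linarith
  have "1 / (align_step a)\<^sup>2 - 1 = (1 - (align_step a)\<^sup>2) / (align_step a)\<^sup>2"
    using align_step_pos by (simp add: field_simps)
  also have "\<dots> = (1 - a\<^sup>2) * ?s\<^sup>2 / (?s * a + ?k)\<^sup>2"
    unfolding one_minus_align_step_sq unfolding align_step_sq
    using align_sqnorm_ge_1 by simp
  also have "\<dots> \<le> (1 - a\<^sup>2) / (4 * a\<^sup>2)"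
    using mult_left_mono[OF sq, of "1 - a\<^sup>2"] square_le_1 a_pos pos by (simp add: field_simps)
  also have "\<dots> = (1 / a\<^sup>2 - 1) / 4" using a_pos by (simp add: field_simps)
  finally show ?thesis .
qed

end

text \<open>Both functions are continuous at 1 with value 1. They are the two sources of the o(1)
  term: \<open>2 / (1 + a)\<close> relates \<open>2 * (1 - a)\<close> to
  \<open>1 - a\<^sup>2\<close> before the step, \<open>align_gain\<close> does the like after
  it.\<close>

lemma eventually_gain_near_1:
  assumes "h > 0"
  shows "\<forall>\<^sub>F a in nhds 1. \<bar>align_gain a - 1\<bar> < h \<and> \<bar>2 / (1 + a) - 1\<bar> < h"
proof -
  have root: "isCont align_root 1" unfolding align_root_def by (intro continuous_intros)
  have "isCont align_weight 1" unfolding align_weight_def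
    using root by (auto intro!: continuous_intros simp: align_root_def)
  then have sqnorm: "isCont align_sqnorm 1" unfolding align_sqnorm_def
    using root by (auto intro!: continuous_intros simp: align_root_def)
  have sqnorm1: "align_sqnorm 1 = 4"
    by (simp add: align_sqnorm_def align_weight_def align_root_def)
  have "isCont align_step 1" unfolding align_step_def
    using root sqnorm \<open>isCont align_weight 1\<close>
    by (auto intro!: continuous_intros simp: align_root_def sqnorm1)
  moreover have step1: "align_step 1 = 1"
    by (simp add: align_step_def align_weight_def align_root_def sqnorm1)
  ultimately have "isCont align_gain 1" unfolding align_gain_def
    using root sqnorm by (auto intro!: continuous_intros simp: align_root_def sqnorm1)
  moreover have "align_gain 1 = 1"
    by (simp add: align_gain_def align_root_def sqnorm1 step1)
  ultimately have "(align_gain \<longlongrightarrow> 1) (nhds 1)"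
    by (simp add: continuous_at tendsto_nhds_iff)
  moreover have "((\<lambda>a::real. 2 / (1 + a)) \<longlongrightarrow> 2 / (1 + 1)) (nhds 1)"
    by (intro tendsto_intros filterlim_ident) simp
  then have "((\<lambda>a::real. 2 / (1 + a)) \<longlongrightarrow> 1) (nhds 1)" by simp
  ultimately show ?thesis
    using assms by (auto intro!: eventually_conj simp: tendsto_iff dist_real_def)
qed

section \<open>Convergence\<close>

text \<open>Positivity of both alignments is the invariant: it makes
  \<open>\<sigma> * (v \<bullet> vs t)\<close> and \<open>\<sigma> * (u \<bullet> us t)\<close>
  admissible as the multiplier \<open>c\<close> of \<open>r2rils_factor_step\<close>, and
  \<open>align_step\<close> preserves it.\<close>

lemma r2rils_run_step:
  fixes u :: "real ^ 'm" and v :: "real ^ 'n"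
  assumes \<sigma>: "\<sigma> > 0" and u: "norm u = 1" and v: "norm v = 1"
    and run: "r2rils_run (\<sigma> *\<^sub>R outer u v) us vs" "u \<bullet> us 1 > 0" "v \<bullet> vs 1 > 0" and t: "t \<ge> 1"
  shows "norm (us t) = 1 \<and> norm (vs t) = 1 \<and> u \<bullet> us t > 0 \<and> v \<bullet> vs t > 0 \<and>
    u \<bullet> us t \<le> 1 \<and> v \<bullet> vs t \<le> 1 \<and>
    u \<bullet> us (t + 1) = align_step (u \<bullet> us t) \<and> v \<bullet> vs (t + 1) = align_step (v \<bullet> vs t)"
proof -
  \<comment> \<open>Stated under the invariant, so that it serves both the induction below and the
    conclusion.\<close>
  have next_iterate: "norm (us (t + 1)) = 1 \<and> norm (vs (t + 1)) = 1 \<and>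
      u \<bullet> us t \<le> 1 \<and> v \<bullet> vs t \<le> 1 \<and>
      u \<bullet> us (t + 1) = align_step (u \<bullet> us t) \<and> v \<bullet> vs (t + 1) = align_step (v \<bullet> vs t)"
    if "t \<ge> 1" and n: "norm (us t) = 1" "norm (vs t) = 1" and p: "u \<bullet> us t > 0" "v \<bullet> vs t > 0" for t
  proof -
    let ?a = "(\<sigma> * (v \<bullet> vs t)) *\<^sub>R (u - ((u \<bullet> us t) / 2) *\<^sub>R us t)"
    let ?b = "(\<sigma> * (u \<bullet> us t)) *\<^sub>R (v - ((v \<bullet> vs t) / 2) *\<^sub>R vs t)"
    have "(us (t + 1), vs (t + 1)) = r2rils_step (\<sigma> *\<^sub>R outer u v) (us t, vs t)"
      using run(1) \<open>t \<ge> 1\<close> by (simp add: r2rils_run_def)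
    then have next_eqs: "us (t + 1) = sgn (us t + sgn ?a)" "vs (t + 1) = sgn (vs t + sgn ?b)"
      by (simp_all add: r2rils_step_def min_norm_lsq_rank1[OF n])
    have "\<sigma> * (v \<bullet> vs t) > 0" "\<sigma> * (u \<bullet> us t) > 0" using \<sigma> p by simp_all
    then show ?thesis
      using r2rils_factor_step[OF u n(1) p(1) _ next_eqs(1)] r2rils_factor_step[OF v n(2) p(2) _ next_eqs(2)]
        norm_cauchy_schwarz[of u "us t"] norm_cauchy_schwarz[of v "vs t"] u v n by simp
  qed
  have "norm (us t) = 1 \<and> norm (vs t) = 1 \<and> u \<bullet> us t > 0 \<and> v \<bullet> vs t > 0"
    using t
  proof (induction t rule: dec_induct)
    case base
    then show ?case using run by (simp add: r2rils_run_def)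
  next
    case (step t)
    then show ?case using next_iterate[of t] align_step_pos by simp
  qed
  then show ?thesis using next_iterate[OF t] by blast
qed

lemma unit_dist_sq:
  fixes u x :: "'a::real_inner"
  assumes "norm u = 1" "norm x = 1"
  shows "(norm (x - u))\<^sup>2 = 2 * (1 - u \<bullet> x)"
  using assms by (simp add: power2_norm_eq_inner norm_eq_1 inner_diff_left inner_diff_right inner_commute)

lemma norm_Pair_sq: "(norm (x, y))\<^sup>2 = (norm x)\<^sup>2 + (norm y)\<^sup>2"
  by (simp add: norm_Pair)

text \<open>The squared tangent shrinks at least by the factor 4 per step, and
  \<open>1 - a t\<close> is at most the squared sine, hence at most the squared tangent.\<close>

lemma align_iteration_tendsto:
  fixes a :: "nat \<Rightarrow> real"
  assumes a: "\<And>t. t \<ge> 1 \<Longrightarrow> 0 < a t \<and> a t \<le> 1 \<and> a (t + 1) = align_step (a t)"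
  shows "a \<longlonglongrightarrow> 1"
proof -
  \<comment> \<open>Shifted by one because the recursion is only known from index 1 on.\<close>
  define T where "T t = 1 / (a (t + 1))\<^sup>2 - 1" for t
  have T: "T t \<le> T 0 * (1 / 4) ^ t" for t
  proof (induction t)
    case (Suc t)
    have "T (Suc t) \<le> T t / 4"
      using align_step_tangent[of "a (t + 1)"] a[of "t + 1"] by (simp add: T_def)
    with Suc show ?case by simp
  qed simp
  have bound: "0 \<le> 1 - a (t + 1)" "1 - a (t + 1) \<le> T t" for t
  proof -
    have p: "0 < a (t + 1)" "a (t + 1) \<le> 1" using a[of "t + 1"] by auto
    then show "0 \<le> 1 - a (t + 1)" by simp
    have "(a (t + 1))\<^sup>2 \<le> 1" "(a (t + 1))\<^sup>2 \<le> a (t + 1)"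
      using p by (auto simp: power_le_one power_decreasing[of 1 2, simplified])
    moreover from this have "1 - (a (t + 1))\<^sup>2 \<le> T t"
    proof -
      have "(1 - (a (t + 1))\<^sup>2) * (a (t + 1))\<^sup>2 \<le> (1 - (a (t + 1))\<^sup>2) * 1"
        using \<open>(a (t + 1))\<^sup>2 \<le> 1\<close> by (intro mult_left_mono) auto
      then show ?thesis using p by (simp add: T_def field_simps)
    qed
    ultimately show "1 - a (t + 1) \<le> T t" using p by linarith
  qed
  have "(\<lambda>t. T 0 * (1 / 4) ^ t) \<longlonglongrightarrow> T 0 * 0"
    by (intro tendsto_mult tendsto_const LIMSEQ_power_zero) simp
  then have "(\<lambda>t. T 0 * (1 / 4) ^ t) \<longlonglongrightarrow> 0" by simp
  then have "(\<lambda>t. 1 - a (t + 1)) \<longlonglongrightarrow> 0"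
    by (rule tendsto_sandwich[OF always_eventually always_eventually tendsto_const, rotated 2])
       (use bound(1) order_trans[OF bound(2) T] in blast)+
  then have "(\<lambda>t. 1 - (1 - a (t + 1))) \<longlonglongrightarrow> 1 - 0"
    by (intro tendsto_diff tendsto_const)
  then show ?thesis using LIMSEQ_offset[of a 1 1] by simp
qed

section \<open>Algebra of the contraction factor\<close>

lemma contraction_factor_bound: "contraction_factor e d \<le> sqrt 2 * max (e\<^sup>2) (d\<^sup>2)"
proof -
  define p q where "p = e\<^sup>2" and "q = d\<^sup>2"
  have pq: "0 \<le> p" "0 \<le> q" by (simp_all add: p_def q_def)
  have "e ^ 4 - e\<^sup>2 * d\<^sup>2 + d ^ 4 = p\<^sup>2 - p * q + q\<^sup>2"
    by (simp add: p_def q_def power2_eq_square power4_eq_xxxx)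
  also have "\<dots> \<le> p\<^sup>2 + q\<^sup>2" using pq by simp
  also have "\<dots> \<le> (max p q)\<^sup>2 + (max p q)\<^sup>2" using pq by (intro add_mono power_mono) auto
  finally have "contraction_factor e d \<le> sqrt (2 * (max p q)\<^sup>2)"
    unfolding contraction_factor_def by simp
  also have "\<dots> = sqrt 2 * max p q" using pq by (simp add: real_sqrt_mult)
  finally show ?thesis by (simp add: p_def q_def)
qed

text \<open>With \<open>p = e\<^sup>2\<close> and \<open>q = d\<^sup>2\<close> the radicand is the
  cofactor of \<open>p + q\<close> in \<open>p ^ 3 + q ^ 3\<close>. The product form avoids dividing
  by a sum that may be 0.\<close>

lemma contraction_factor_nonneg: "0 \<le> contraction_factor e d"
  and contraction_factor_sq:
    "(contraction_factor e d)\<^sup>2 * (e\<^sup>2 + d\<^sup>2) = (e\<^sup>2) ^ 3 + (d\<^sup>2) ^ 3"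
proof -
  have "0 \<le> (e\<^sup>2 - d\<^sup>2)\<^sup>2 + e\<^sup>2 * d\<^sup>2" by simp
  then have nonneg: "0 \<le> e ^ 4 - e\<^sup>2 * d\<^sup>2 + d ^ 4"
    by (simp add: power2_eq_square power4_eq_xxxx algebra_simps)
  then show "0 \<le> contraction_factor e d" by (simp add: contraction_factor_def)
  have sq: "(contraction_factor e d)\<^sup>2 = e ^ 4 - e\<^sup>2 * d\<^sup>2 + d ^ 4"
    using nonneg by (simp add: contraction_factor_def)
  show "(contraction_factor e d)\<^sup>2 * (e\<^sup>2 + d\<^sup>2) = (e\<^sup>2) ^ 3 + (d\<^sup>2) ^ 3"
    unfolding sq by (simp add: algebra_simps power2_eq_square power3_eq_cube power4_eq_xxxx)
qed

text \<open>Here \<open>e\<close>, \<open>d\<close> stand for the squared sines, \<open>D\<close>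
  and \<open>D'\<close> for the errors before and after a step, \<open>C\<close> for the contraction
  factor. Coefficients within \<open>h\<close> of 1 change each sum by a relative error of at most
  \<open>h\<close>, so the square of \<open>D' / (D * C)\<close> lies between
  \<open>(1 - h) / (1 + h)\<close> and its inverse.\<close>

lemma perturbed_ratio:
  fixes C e d f f' g g' D D' :: real
  assumes h: "0 < h" "h < 1 / 3"
    and f: "\<bar>f - 1\<bar> < h" "\<bar>f' - 1\<bar> < h" and g: "\<bar>g - 1\<bar> < h" "\<bar>g' - 1\<bar> < h"
    and e: "0 \<le> e" "0 \<le> d" "0 < e + d" and nonneg: "0 \<le> D" "0 \<le> D'" and C: "0 \<le> C"
    and D': "D'\<^sup>2 = e ^ 3 * f + d ^ 3 * f'" and D: "D\<^sup>2 = e * g + d * g'"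
    and CC: "C\<^sup>2 * (e + d) = e ^ 3 + d ^ 3"
  shows "\<exists>w. \<bar>w\<bar> < 3 * h \<and> D' / D = C * (1 + w)"
proof -
  have S: "0 < e ^ 3 + d ^ 3"
    using e by (cases "e = 0") (auto intro: add_pos_nonneg)
  then have C0: "C > 0" using CC C by (cases "C = 0") auto
  have up: "p * x + q * y \<le> (1 + h) * (p + q)" and lo: "(1 - h) * (p + q) \<le> p * x + q * y"
    if "0 \<le> p" "0 \<le> q" "\<bar>x - 1\<bar> < h" "\<bar>y - 1\<bar> < h" for p q x y :: real
  proof -
    have "p * x \<le> p * (1 + h)" "q * y \<le> q * (1 + h)"
        "p * (1 - h) \<le> p * x" "q * (1 - h) \<le> q * y"
      using that by (auto intro!: mult_left_mono)
    then show "p * x + q * y \<le> (1 + h) * (p + q)" "(1 - h) * (p + q) \<le> p * x + q * y"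
      by (simp_all add: algebra_simps)
  qed
  have e3: "0 \<le> e ^ 3" "0 \<le> d ^ 3" using e by simp_all
  note up = up[OF e3 f, folded D'] up[OF e(1,2) g, folded D]
    and lo = lo[OF e3 f, folded D'] lo[OF e(1,2) g, folded D]
  have "0 < (1 - h) * (e + d)" using h e by simp
  then have D0: "D > 0" using lo(2) \<open>0 \<le> D\<close> by (cases "D = 0") auto
  define R where "R = D' / (D * C)"
  have R0: "0 \<le> R" using D0 C0 \<open>0 \<le> D'\<close> by (simp add: R_def)
  have R: "R\<^sup>2 * (C\<^sup>2 * D\<^sup>2) = D'\<^sup>2"
    using D0 C0 by (simp add: R_def power_divide power_mult_distrib)
  have eq: "C\<^sup>2 * (c * (e + d)) = c * (e ^ 3 + d ^ 3)" for c
    by (metis CC mult.left_commute)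
  have "R\<^sup>2 * ((1 - h) * (e ^ 3 + d ^ 3)) \<le> R\<^sup>2 * (C\<^sup>2 * D\<^sup>2)"
    using mult_left_mono[OF lo(2) zero_le_power2[of C], unfolded eq] by (intro mult_left_mono) auto
  also have "\<dots> \<le> (1 + h) * (e ^ 3 + d ^ 3)" using up R by simp
  finally have 1: "R\<^sup>2 * (1 - h) \<le> 1 + h" using S by (simp add: mult.assoc[symmetric])
  have "(1 - h) * (e ^ 3 + d ^ 3) \<le> R\<^sup>2 * (C\<^sup>2 * D\<^sup>2)" using lo R by simp
  also have "\<dots> \<le> R\<^sup>2 * ((1 + h) * (e ^ 3 + d ^ 3))"
    using mult_left_mono[OF up(2) zero_le_power2[of C], unfolded eq] by (intro mult_left_mono) auto
  finally have 2: "1 - h \<le> R\<^sup>2 * (1 + h)" using S by (simp add: mult.assoc[symmetric])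
  \<comment> \<open>In \<open>(1 + 3 * h) * (1 - h)\<close>, which expands to
    \<open>1 + 2 * h - 3 * h * h\<close>, the quadratic term must stay below
    \<open>h\<close>.\<close>
  have hh: "0 < h * h" "h * h < h / 3" using h mult_strict_left_mono[of h "1/3" h] by auto
  have "R < 1 + 3 * h"
  proof (rule ccontr)
    assume "\<not> R < 1 + 3 * h"
    then have "(1 + 3 * h) * 1 \<le> R * R" using h by (intro mult_mono) auto
    then have "(1 + 3 * h) * (1 - h) \<le> R\<^sup>2 * (1 - h)"
      using h by (intro mult_right_mono) (auto simp: power2_eq_square)
    with 1 hh show False by (simp add: algebra_simps)
  qed
  moreover have "1 - 3 * h < R"
  proof (rule ccontr)
    assume "\<not> 1 - 3 * h < R"
    then have "R * R \<le> (1 - 3 * h) * 1" using h R0 by (intro mult_mono) auto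
    then have "R\<^sup>2 * (1 + h) \<le> (1 - 3 * h) * (1 + h)"
      using h by (intro mult_right_mono) (auto simp: power2_eq_square)
    with 2 hh show False by (simp add: algebra_simps)
  qed
  moreover have "D' / D = C * (1 + (R - 1))" using C0 by (simp add: R_def)
  ultimately show ?thesis by (intro exI[of _ "R - 1"]) auto
qed

theorem theorem2:
  fixes \<sigma> :: real
    and u :: "real ^ 'm"
    and v :: "real ^ 'n"
    and X :: "real ^ 'n ^ 'm"
  assumes "\<sigma> > 0"
    and "norm u = 1"
    and "norm v = 1"
    and "X = \<sigma> *\<^sub>R outer u v"
  shows "(\<forall>us vs. r2rils_run X us vs \<and> u \<bullet> us 1 > 0 \<and> v \<bullet> vs 1 > 0 \<longrightarrow>
            converges_quadratically (\<lambda>t. (us t, vs t)) (u, v) \<and>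
            (\<forall>t\<ge>1. let \<epsilon> = misalignment u (us t); \<delta> = misalignment v (vs t) in
               contraction_factor \<epsilon> \<delta> \<le> sqrt 2 * max (\<epsilon>\<^sup>2) (\<delta>\<^sup>2)))
       \<and> (\<forall>\<eta>>0. \<exists>r>0. \<forall>us vs. r2rils_run X us vs \<and> u \<bullet> us 1 > 0 \<and> v \<bullet> vs 1 > 0 \<longrightarrow>
            (\<forall>t\<ge>1. let \<epsilon> = misalignment u (us t); \<delta> = misalignment v (vs t) in
               (\<epsilon>, \<delta>) \<noteq> (0, 0) \<and> \<epsilon> < r \<and> \<delta> < r \<longrightarrow>
               (\<exists>\<omega>. \<bar>\<omega>\<bar> < \<eta> \<and>
                  norm ((us (t + 1), vs (t + 1)) - (u, v)) / norm ((us t, vs t) - (u, v))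
                    = contraction_factor \<epsilon> \<delta> * (1 + \<omega>))))"
proof (intro conjI allI impI)
  fix us vs assume run: "r2rils_run X us vs \<and> u \<bullet> us 1 > 0 \<and> v \<bullet> vs 1 > 0"
  note step = r2rils_run_step[OF assms(1-3), of us vs, folded assms(4)]
  let ?z = "\<lambda>t. (us t, vs t)"
  have S: "norm (us t) = 1" "norm (vs t) = 1" "u \<bullet> us t > 0" "v \<bullet> vs t > 0"
      "u \<bullet> us t \<le> 1" "v \<bullet> vs t \<le> 1" "u \<bullet> us (t + 1) = align_step (u \<bullet> us t)"
      "v \<bullet> vs (t + 1) = align_step (v \<bullet> vs t)" if "t \<ge> 1" for t
    using step that run by blast+
  have err: "(norm (?z t - (u, v)))\<^sup>2 = 2 * (1 - u \<bullet> us t) + 2 * (1 - v \<bullet> vs t)" if "t \<ge> 1" for t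
    using S[OF that] assms by (simp add: norm_Pair_sq unit_dist_sq)
  have "(\<lambda>t. u \<bullet> us t) \<longlonglongrightarrow> 1" "(\<lambda>t. v \<bullet> vs t) \<longlonglongrightarrow> 1"
    using S by (auto intro!: align_iteration_tendsto)
  then have "(\<lambda>t. sqrt (2 * (1 - u \<bullet> us t) + 2 * (1 - v \<bullet> vs t))) \<longlonglongrightarrow> sqrt (2 * (1 - 1) + 2 * (1 - 1))"
    by (intro tendsto_intros)
  \<comment> \<open>The error formula holds from index 1 on, so the two sequences agree only
    eventually.\<close>
  moreover have "\<forall>\<^sub>F t in sequentially.
      sqrt (2 * (1 - u \<bullet> us t) + 2 * (1 - v \<bullet> vs t)) = norm (?z t - (u, v))"
    using eventually_ge_at_top[of 1] by eventually_elim (metis err norm_ge_zero real_sqrt_unique)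
  ultimately have "(\<lambda>t. norm (?z t - (u, v))) \<longlonglongrightarrow> 0"
    by (auto intro: Lim_transform_eventually)
  then have lim: "?z \<longlonglongrightarrow> (u, v)"
    by (intro LIM_zero_cancel[where l="(u, v)"]) (rule tendsto_norm_zero_cancel)
  \<comment> \<open>The 8 is the square root of the 64 in \<open>align_step_error_quadratic\<close>;
    the bounds of the two factors merge by
    \<open>p\<^sup>2 + q\<^sup>2 \<le> (p + q)\<^sup>2\<close>.\<close>
  have "norm (?z (t + 1) - (u, v)) \<le> 8 * (norm (?z t - (u, v)))\<^sup>2" if t: "t \<ge> 1" for t
  proof (rule power2_le_imp_le)
    define p q where "p = 2 * (1 - u \<bullet> us t)" and "q = 2 * (1 - v \<bullet> vs t)"
    have pq: "0 \<le> p" "0 \<le> q" using S[OF t] by (simp_all add: p_def q_def)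
    have "(norm (?z (t + 1) - (u, v)))\<^sup>2 \<le> 64 * p\<^sup>2 + 64 * q\<^sup>2"
    proof -
      have "(norm (?z (t + 1) - (u, v)))\<^sup>2
          = 2 * (1 - align_step (u \<bullet> us t)) + 2 * (1 - align_step (v \<bullet> vs t))"
        by (subst err) (simp_all add: S(7,8)[OF t, simplified])
      also have "\<dots> \<le> 64 * p\<^sup>2 + 64 * q\<^sup>2"
        unfolding p_def q_def
        by (intro add_mono align_step_error_quadratic S[OF t])
      finally show ?thesis .
    qed
    also have "\<dots> \<le> 64 * (p + q)\<^sup>2" using pq by (simp add: power2_sum)
    also have "\<dots> = (8 * (norm (?z t - (u, v)))\<^sup>2)\<^sup>2"
      unfolding err[OF t, folded p_def q_def] power_mult_distrib by simp
    finally show "(norm (?z (t + 1) - (u, v)))\<^sup>2 \<le> (8 * (norm (?z t - (u, v)))\<^sup>2)\<^sup>2" .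
  qed simp
  then show "converges_quadratically ?z (u, v)"
    unfolding converges_quadratically_def
    using lim by (auto intro!: exI[of _ 8] eventually_at_top_linorderI[of 1])
  show "let \<epsilon> = misalignment u (us t); \<delta> = misalignment v (vs t) in
      contraction_factor \<epsilon> \<delta> \<le> sqrt 2 * max (\<epsilon>\<^sup>2) (\<delta>\<^sup>2)" for t
    by (simp add: Let_def contraction_factor_bound)
next
  fix \<eta> :: real assume "\<eta> > 0"
  \<comment> \<open>The cap 1/2 keeps \<open>h\<close> below 1/3 as \<open>perturbed_ratio\<close>
    requires, and the division by 3 absorbs its loss \<open>3 * h\<close>.\<close>
  define h where "h = min \<eta> (1 / 2) / 3"
  have h: "0 < h" "h < 1 / 3" "3 * h \<le> \<eta>" using \<open>\<eta> > 0\<close> by (auto simp: h_def)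
  obtain r where r: "r > 0"
    and gain: "\<And>a. \<bar>a - 1\<bar> < r \<Longrightarrow> \<bar>align_gain a - 1\<bar> < h \<and> \<bar>2 / (1 + a) - 1\<bar> < h"
    using eventually_gain_near_1[OF h(1)] by (auto simp: eventually_nhds_metric dist_real_def)
  \<comment> \<open>As \<open>1 - w \<bullet> x\<close> is at most the squared sine, a sine below
    \<open>sqrt r\<close> puts the cosine within \<open>r\<close> of 1. Hence \<open>sqrt r\<close>
    is the threshold chosen below, the same for all runs.\<close>
  have near: "(misalignment w x)\<^sup>2 = 1 - (w \<bullet> x)\<^sup>2" "0 \<le> 1 - (w \<bullet> x)\<^sup>2"
      "misalignment w x < sqrt r \<Longrightarrow> \<bar>w \<bullet> x - 1\<bar> < r"
    if "0 < w \<bullet> x" "w \<bullet> x \<le> 1" for w x :: "'c::real_inner"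
  proof -
    show nn: "0 \<le> 1 - (w \<bullet> x)\<^sup>2" using that by (simp add: power_le_one)
    then show "(misalignment w x)\<^sup>2 = 1 - (w \<bullet> x)\<^sup>2" by (simp add: misalignment_def)
    have "(w \<bullet> x)\<^sup>2 \<le> w \<bullet> x" using that by (simp add: power2_eq_square mult_left_le)
    then show "\<bar>w \<bullet> x - 1\<bar> < r" if "misalignment w x < sqrt r"
      using that \<open>w \<bullet> x \<le> 1\<close> by (simp add: misalignment_def)
  qed
  have unit: "2 * (1 - a) = (1 - a\<^sup>2) * (2 / (1 + a))" if "0 < a" for a :: real
    using that by (simp add: field_simps power2_eq_square)
  show "\<exists>r>0. \<forall>us vs. r2rils_run X us vs \<and> u \<bullet> us 1 > 0 \<and> v \<bullet> vs 1 > 0 \<longrightarrow>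
            (\<forall>t\<ge>1. let \<epsilon> = misalignment u (us t); \<delta> = misalignment v (vs t) in
               (\<epsilon>, \<delta>) \<noteq> (0, 0) \<and> \<epsilon> < r \<and> \<delta> < r \<longrightarrow>
               (\<exists>\<omega>. \<bar>\<omega>\<bar> < \<eta> \<and>
                  norm ((us (t + 1), vs (t + 1)) - (u, v)) / norm ((us t, vs t) - (u, v))
                    = contraction_factor \<epsilon> \<delta> * (1 + \<omega>)))"
    unfolding Let_def
  proof (rule exI[of _ "sqrt r"], intro conjI allI impI)
    show "sqrt r > 0" using r by simp
    fix us vs and t :: nat
    assume run: "r2rils_run X us vs \<and> u \<bullet> us 1 > 0 \<and> v \<bullet> vs 1 > 0" and t: "t \<ge> 1"
    let ?e = "misalignment u (us t)" and ?d = "misalignment v (vs t)"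
    let ?a = "u \<bullet> us t" and ?b = "v \<bullet> vs t"
    assume ed: "(?e, ?d) \<noteq> (0, 0) \<and> ?e < sqrt r \<and> ?d < sqrt r"
    note step = r2rils_run_step[OF assms(1-3), of us vs, folded assms(4)]
    have S: "norm (us t) = 1" "norm (vs t) = 1" "?a > 0" "?b > 0" "?a \<le> 1" "?b \<le> 1"
        "u \<bullet> us (t + 1) = align_step ?a" "v \<bullet> vs (t + 1) = align_step ?b"
      using step[of t] t run by blast+
    have S': "norm (us (t + 1)) = 1" "norm (vs (t + 1)) = 1"
      using step[of "t + 1"] run by simp_all
    note near_u = near[OF S(3,5)] and near_v = near[OF S(4,6)]
    have "\<exists>\<omega>. \<bar>\<omega>\<bar> < 3 * h \<and>
        norm ((us (t + 1), vs (t + 1)) - (u, v)) / norm ((us t, vs t) - (u, v))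
          = contraction_factor ?e ?d * (1 + \<omega>)"
    \<comment> \<open>The squared error is a sum of squared sines with coefficients
      \<open>2 / (1 + a)\<close> at \<open>t\<close>, and of their cubes with coefficients
      \<open>align_gain a\<close> at \<open>t + 1\<close>, where \<open>a\<close> is the cosine at
      \<open>t\<close>.\<close>
    proof (rule perturbed_ratio[OF h(1,2), where e = "?e\<^sup>2" and d = "?d\<^sup>2"
          and f = "align_gain ?a" and f' = "align_gain ?b"
          and g = "2 / (1 + ?a)" and g' = "2 / (1 + ?b)"])
      show "\<bar>align_gain ?a - 1\<bar> < h" "\<bar>align_gain ?b - 1\<bar> < h"
          "\<bar>2 / (1 + ?a) - 1\<bar> < h" "\<bar>2 / (1 + ?b) - 1\<bar> < h"
        using gain near_u(3) near_v(3) ed by blast+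
      show "0 < ?e\<^sup>2 + ?d\<^sup>2" using ed by (auto simp: sum_power2_gt_zero_iff)
      show "0 \<le> contraction_factor ?e ?d" by (rule contraction_factor_nonneg)
      show "(norm ((us (t + 1), vs (t + 1)) - (u, v)))\<^sup>2
          = (?e\<^sup>2) ^ 3 * align_gain ?a + (?d\<^sup>2) ^ 3 * align_gain ?b"
        using S S' assms(2,3) align_step_error[OF S(3,5)] align_step_error[OF S(4,6)]
        by (simp add: norm_Pair_sq unit_dist_sq near_u near_v)
      show "(norm ((us t, vs t) - (u, v)))\<^sup>2 = ?e\<^sup>2 * (2 / (1 + ?a)) + ?d\<^sup>2 * (2 / (1 + ?b))"
        using S assms(2,3) unit[OF S(3)] unit[OF S(4)]
        by (simp add: norm_Pair_sq unit_dist_sq near_u near_v)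
      show "(contraction_factor ?e ?d)\<^sup>2 * (?e\<^sup>2 + ?d\<^sup>2) = (?e\<^sup>2) ^ 3 + (?d\<^sup>2) ^ 3"
        by (rule contraction_factor_sq)
    qed simp_all
    then show "\<exists>\<omega>. \<bar>\<omega>\<bar> < \<eta> \<and>
        norm ((us (t + 1), vs (t + 1)) - (u, v)) / norm ((us t, vs t) - (u, v))
          = contraction_factor ?e ?d * (1 + \<omega>)"
      using h(3) by (meson less_le_trans)
  qed
qed

end
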